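(* Let $q$ be a prime power. When $n$ is an even positive integer, the number of $(n-1)\times(n-1)$ symmetric invertible matrices over $\mathbf{F}_q$ is equal to the number of $n\times n$ symmetric invertible matrices over $\mathbf{F}_q$ with zero diagonal, i.e., $\mathrm{sym}(n-1)=\mathrm{sym}_0(n)$.
   Context: $\mathbf{F}_q$ denotes the field with $q$ elements. $\mathrm{sym}(m)$ denotes the number of $m\times m$ symmetric invertible matrices over $\mathbf{F}_q$, and $\mathrm{sym}_0(m)$ denotes the number of $m\times m$ symmetric invertible matrices over $\mathbf{F}_q$ all of whose diagonal entries are zero. *)

theory Defs
  imports "HOL-Library.Cardinality" "Jordan_Normal_Form.Matrix" "HOL-Number_Theory.Prime_Powers"
begin

text \<open>
  The field with \<open>q\<close> elements is a type \<open>'a\<close> of class \<open>field\<close> and \<open>finite\<close> with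
  \<open>CARD('a) = q\<close>, passed to the counting functions as an argument of type \<open>'a itself\<close>.
\<close>

definition sym_inv_mats :: "'a::{field,finite} itself \<Rightarrow> nat \<Rightarrow> 'a mat set" where
  "sym_inv_mats _ m = {A \<in> carrier_mat m m. transpose_mat A = A \<and> invertible_mat A}"

definition sym_count :: "'a::{field,finite} itself \<Rightarrow> nat \<Rightarrow> nat" where
  "sym_count F m = card (sym_inv_mats F m)"

definition sym0_count :: "'a::{field,finite} itself \<Rightarrow> nat \<Rightarrow> nat" where
  "sym0_count F m = card {A \<in> sym_inv_mats F m. \<forall>i<m. A $$ (i, i) = 0}"

end

theory Submission
  imports Defs "Jordan_Normal_Form.Determinant"
begin

text \<open>
  Write \<open>f(n)\<close> for the number of invertible symmetric \<open>n \<times> n\<close> matrices over the field with \<open>q\<close>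
  elements. For even \<open>n\<close>, both sides of the claim equal \<open>f(n) / q\<^sup>n\<close>. What makes this work is one
  fact about quadratic forms: a nondegenerate symmetric bilinear form in an odd number \<open>m\<close> of
  variables has exactly \<open>q\<^sup>m\<^sup>-\<^sup>1\<close> isotropic vectors, whatever the form and in every
  characteristic (\<open>isotropic_count_odd\<close>).

  To use it, split off the first row and column, so that a symmetric matrix of even size \<open>m + 1\<close> is a
  corner entry \<open>c\<close>, a vector \<open>v\<close> and a symmetric block \<open>B\<close> of odd size \<open>m\<close>. Its determinant is
  affine in \<open>c\<close> with slope \<open>det B\<close>. If \<open>B\<close> is singular, invertibility does not depend on \<open>c\<close>. If
  \<open>B\<close> is invertible and \<open>v = B w\<close>, the determinant is \<open>(c - w \<bullet> B w) det B\<close>, so the invertible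
  pairs \<open>(c, v)\<close> number \<open>q\<^sup>m (q - 1)\<close>, and those with \<open>c = 0\<close> number \<open>q\<^sup>m - q\<^sup>m\<^sup>-\<^sup>1\<close> by
  the fact above. In both cases requiring \<open>c = 0\<close> divides the count by exactly \<open>q\<close>, and it does so
  block by block; hence other diagonal entries may be required to vanish at the same time
  (\<open>card_zero_diagonal_on_insert\<close>).

  Imposing all \<open>n\<close> diagonal conditions one after the other gives \<open>f(n) = q\<^sup>n sym\<^sub>0(n)\<close>.
  Imposing only the first shows that the matrices with nonzero corner make up the fraction
  \<open>(q - 1) / q\<close> of \<open>f(n)\<close>; the Schur complement counts them as \<open>(q - 1) q\<^sup>n\<^sup>-\<^sup>1 f(n - 1)\<close>
  (\<open>card_nonzero_corner\<close>). Therefore \<open>f(n) = q\<^sup>n f(n - 1)\<close>, and the two evaluations of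
  \<open>f(n)\<close> agree.

  The count of isotropic vectors goes together with a statement in even dimension: there all nonzero
  values are taken equally often (\<open>representations_even\<close>). Splitting off a line spanned by a
  nonisotropic vector passes from even to odd dimension; splitting off two such lines is an induction
  step between even dimensions, because a binary form \<open>a x\<^sup>2 + b y\<^sup>2\<close> takes all nonzero values
  equally often. In odd dimension a nonisotropic vector always exists, since alternating forms are
  nondegenerate only in even dimension.
\<close>

section \<open>Binary diagonal forms over a finite field\<close>

lemma card_field_gt_1: "CARD('a::{field,finite}) > 1"
  using card_mono[of "UNIV :: 'a set" "{0, 1}"] by simp

text \<open>
  Squaring is at most two-to-one, and zero has a single square root; so the squares make up more than
  half of the field.
\<close>

lemma card_squares:
  "CARD('a::{field,finite}) < 2 * card (range (\<lambda>x::'a. x^2))"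
proof -
  let ?S = "range (\<lambda>x::'a. x^2)"
  have le: "card {x::'a. x^2 = s} \<le> 2" for s
  proof (cases "\<exists>y. y^2 = s")
    case True
    then obtain y where "y^2 = s" by blast
    then have "{x. x^2 = s} \<subseteq> {y, - y}" by (auto simp: power2_eq_iff)
    then have "card {x. x^2 = s} \<le> card {y, - y}" by (rule card_mono[rotated]) simp
    also have "\<dots> \<le> 2" by (simp add: card_insert_if)
    finally show ?thesis .
  qed (auto simp: card_eq_0_iff)
  have "CARD('a) = card (\<Union>s\<in>?S. {x. x^2 = s})" by (rule arg_cong[where f=card]) auto
  also have "\<dots> \<le> (\<Sum>s\<in>?S. card {x. x^2 = s})" by (rule card_UN_le) simp
  also have "\<dots> = card {x::'a. x^2 = 0} + (\<Sum>s\<in>?S - {0}. card {x. x^2 = s})"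
    by (rule sum.remove) auto
  also have "\<dots> \<le> 1 + (\<Sum>s\<in>?S - {0}. 2)"
    by (intro add_mono sum_mono le) simp
  also have "\<dots> = 1 + 2 * (card ?S - 1)" by (subst sum_constant, subst card_Diff_singleton) auto
  also have "\<dots> < 2 * card ?S"
    using card_gt_0_iff[of ?S] by auto
  finally show ?thesis .
qed

text \<open>
  The values of \<open>u\<^sup>2\<close> and those of \<open>d - e w\<^sup>2\<close> both fill more than half of the field,
  so these two sets meet.
\<close>

lemma binary_form_universal:
  fixes e :: "'a::{field,finite}"
  assumes "e \<noteq> 0"
  shows "\<exists>u w. u^2 + e * w^2 = d"
proof (rule ccontr)
  assume no: "\<not> ?thesis"
  let ?S = "range (\<lambda>x::'a. x^2)"
  let ?T = "(\<lambda>s. d - e * s) ` ?S"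
  have "card ?T = card ?S" by (rule card_image) (use assms in \<open>auto simp: inj_on_def\<close>)
  moreover have "?S \<inter> ?T = {}"
  proof -
    have False if "u^2 = d - e * w^2" for u w :: 'a
      using no that by (metis diff_add_cancel)
    then show ?thesis by blast
  qed
  then have "card (?S \<union> ?T) = card ?S + card ?T" by (intro card_Un_disjoint) auto
  moreover have "card (?S \<union> ?T) \<le> CARD('a)" by (rule card_mono) auto
  ultimately show False using card_squares[where 'a='a] by linarith
qed

text \<open>
  With \<open>e = b / a\<close>, the form \<open>x\<^sup>2 + e y\<^sup>2\<close> is multiplicative, being the norm form
  \<open>(x + y \<surd>(-e)) (x - y \<surd>(-e))\<close>. Multiplication by an element of norm \<open>d / c\<close> carries the
  solutions for \<open>c\<close> injectively to those for \<open>d\<close>.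
\<close>

lemma binary_form_representations:
  fixes a b c d :: "'a::{field,finite}"
  assumes nz: "a \<noteq> 0" "b \<noteq> 0" "c \<noteq> 0" "d \<noteq> 0"
  shows "card {(x, y). a * x^2 + b * y^2 = c} = card {(x, y). a * x^2 + b * y^2 = d}"
proof -
  have le: "card {(x, y). a * x^2 + b * y^2 = c} \<le> card {(x, y). a * x^2 + b * y^2 = d}"
    if cd: "c \<noteq> 0" "d \<noteq> 0" for c d
  proof -
    define e where "e = b / a"
    have b: "b = a * e" using nz by (simp add: e_def)
    have "e \<noteq> 0" using nz by (simp add: e_def)
    from binary_form_universal[OF this] obtain u w where uw: "u^2 + e * w^2 = d / c" by blast
    have nz': "u^2 + e * w^2 \<noteq> 0" using uw cd by simp
    let ?f = "\<lambda>(x, y). (u * x - e * w * y, w * x + u * y)"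
    show ?thesis
    proof (rule card_inj_on_le[where f = ?f])
      show "inj_on ?f {(x, y). a * x^2 + b * y^2 = c}"
      proof (rule inj_onI, clarify, goal_cases)
        case (1 x y x' y')
        have "(u^2 + e * w^2) * (x - x') =
            u * ((u * x - e * w * y) - (u * x' - e * w * y')) +
            e * w * ((w * x + u * y) - (w * x' + u * y'))"
          by (simp add: power2_eq_square algebra_simps)
        moreover have "(u^2 + e * w^2) * (y - y') =
            u * ((w * x + u * y) - (w * x' + u * y')) -
            w * ((u * x - e * w * y) - (u * x' - e * w * y'))"
          by (simp add: power2_eq_square algebra_simps)
        ultimately show ?case using 1 nz' by auto
      qed
      have "a * (u * x - e * w * y)^2 + b * (w * x + u * y)^2 = d" if "a * x^2 + b * y^2 = c" for x y
      proof -
        have "a * (u * x - e * w * y)^2 + b * (w * x + u * y)^2 =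
            (u^2 + e * w^2) * (a * x^2 + b * y^2)"
          unfolding b by (simp add: power2_eq_square algebra_simps)
        then show ?thesis using that uw cd by simp
      qed
      then show "?f ` {(x, y). a * x^2 + b * y^2 = c} \<subseteq> {(x, y). a * x^2 + b * y^2 = d}" by auto
    qed simp
  qed
  from le[OF nz(3,4)] le[OF nz(4,3)] show ?thesis by simp
qed

section \<open>Nondegenerate symmetric bilinear forms\<close>

lemma card_carrier_vec:
  "card (carrier_vec n :: 'a::{field,finite} vec set) = CARD('a) ^ n \<and>
   finite (carrier_vec n :: 'a vec set)"
proof (induction n)
  case 0
  have "(carrier_vec 0 :: 'a vec set) = {vNil}" by auto
  then show ?case by simp
next
  case (Suc n)
  have bij: "bij_betw (\<lambda>(c, v). vCons c v) (UNIV \<times> (carrier_vec n :: 'a vec set)) (carrier_vec (Suc n))"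
  proof (rule bij_betwI')
    fix v :: "'a vec" assume "v \<in> carrier_vec (Suc n)"
    then show "\<exists>x\<in>UNIV \<times> carrier_vec n. v = (case x of (c, v) \<Rightarrow> vCons c v)"
      by (cases v) auto
  qed auto
  from bij_betw_same_card[OF bij] bij_betw_finite[OF bij] Suc
  show ?case by (simp add: card_cartesian_product)
qed

locale symmetric_form =
  fixes n :: nat and b :: "'a::{field,finite} vec \<Rightarrow> 'a vec \<Rightarrow> 'a"
  assumes add_left: "\<lbrakk>x \<in> carrier_vec n; y \<in> carrier_vec n; z \<in> carrier_vec n\<rbrakk>
      \<Longrightarrow> b (x + y) z = b x z + b y z"
    and smult_left: "\<lbrakk>x \<in> carrier_vec n; y \<in> carrier_vec n\<rbrakk> \<Longrightarrow> b (k \<cdot>\<^sub>v x) y = k * b x y"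
    and sym: "\<lbrakk>x \<in> carrier_vec n; y \<in> carrier_vec n\<rbrakk> \<Longrightarrow> b x y = b y x"
begin

lemma add_right: "\<lbrakk>x \<in> carrier_vec n; y \<in> carrier_vec n; z \<in> carrier_vec n\<rbrakk>
      \<Longrightarrow> b z (x + y) = b z x + b z y"
  using add_left[of x y z] sym[of z] by simp

lemma smult_right: "\<lbrakk>x \<in> carrier_vec n; y \<in> carrier_vec n\<rbrakk> \<Longrightarrow> b x (k \<cdot>\<^sub>v y) = k * b x y"
  using smult_left[of y x k] sym[of x] by simp

definition linear_subspace :: "'a vec set \<Rightarrow> bool" where
  "linear_subspace V \<longleftrightarrow> V \<subseteq> carrier_vec n \<and> 0\<^sub>v n \<in> V \<and> (\<forall>x\<in>V. \<forall>y\<in>V. x + y \<in> V) \<and>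
     (\<forall>k. \<forall>x\<in>V. k \<cdot>\<^sub>v x \<in> V)"

text \<open>
  The restriction of the form to the subspace is nondegenerate. Working with subspaces of one fixed
  space keeps orthogonal complements within reach of the same induction, and their dimension \<open>d\<close> is
  recorded as the cardinality \<open>q\<^sup>d\<close>.
\<close>

definition regular :: "'a vec set \<Rightarrow> bool" where
  "regular V \<longleftrightarrow> linear_subspace V \<and> (\<forall>x\<in>V. (\<forall>y\<in>V. b x y = 0) \<longrightarrow> x = 0\<^sub>v n)"

definition orth_complement :: "'a vec set \<Rightarrow> 'a vec set \<Rightarrow> 'a vec set" where
  "orth_complement U V = {v \<in> V. \<forall>u\<in>U. b v u = 0}"

definition representations :: "'a vec set \<Rightarrow> 'a \<Rightarrow> nat" where
  "representations V c = card {v \<in> V. b v v = c}"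

lemma linear_subspaceD:
  assumes "linear_subspace V"
  shows "x \<in> V \<Longrightarrow> x \<in> carrier_vec n" "0\<^sub>v n \<in> V" "x \<in> V \<Longrightarrow> y \<in> V \<Longrightarrow> x + y \<in> V"
    "x \<in> V \<Longrightarrow> k \<cdot>\<^sub>v x \<in> V" "finite V"
  using assms card_carrier_vec[of n, where 'a='a] unfolding linear_subspace_def
  by (auto intro: finite_subset)

lemma zero_left: "x \<in> carrier_vec n \<Longrightarrow> b (0\<^sub>v n) x = 0"
proof -
  assume x: "x \<in> carrier_vec n"
  have "0 \<cdot>\<^sub>v 0\<^sub>v n = (0\<^sub>v n :: 'a vec)" by auto
  with smult_left[of "0\<^sub>v n" x 0] x show ?thesis by simp
qed

lemma sum_representations:
  assumes "linear_subspace V" shows "(\<Sum>c\<in>UNIV. representations V c) = card V"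
proof -
  have "card V = card (\<Union>c. {v \<in> V. b v v = c})" by (rule arg_cong[where f=card]) auto
  also have "\<dots> = (\<Sum>c\<in>UNIV. card {v \<in> V. b v v = c})"
    by (rule card_UN_disjoint) (use linear_subspaceD(5)[OF assms] in auto)
  finally show ?thesis by (simp add: representations_def)
qed

text \<open>
  An orthogonal direct sum \<open>V = U \<oplus> W\<close>: the value at \<open>u + w\<close> is the sum of the values at \<open>u\<close> and
  \<open>w\<close>, and a vector of \<open>W\<close> orthogonal to \<open>W\<close> is orthogonal to all of \<open>V\<close>. The decomposition is
  a hypothesis; below, \<open>U\<close> is a line or a hyperbolic plane, where the projection is explicit.
\<close>

lemma orthogonal_splitting:
  assumes V: "regular V" and U: "linear_subspace U" "U \<subseteq> V"
    and split: "\<And>v. v \<in> V \<Longrightarrow> \<exists>u\<in>U. v - u \<in> orth_complement U V"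
    and meet: "\<And>u. u \<in> U \<Longrightarrow> u \<in> orth_complement U V \<Longrightarrow> u = 0\<^sub>v n"
  shows "regular (orth_complement U V)"
    and "card V = card U * card (orth_complement U V)"
    and "representations V c = (\<Sum>u\<in>U. representations (orth_complement U V) (c - b u u))"
proof -
  let ?W = "orth_complement U V"
  have sV: "linear_subspace V" using V by (simp add: regular_def)
  note D = linear_subspaceD[OF sV] and E = linear_subspaceD[OF U(1)]
  have W: "\<And>w. w \<in> ?W \<Longrightarrow> w \<in> V" by (auto simp: orth_complement_def)
  have UV: "b u w = 0" "b w u = 0" if "u \<in> U" "w \<in> ?W" for u w
    using that sym[of w u] D(1) E(1) by (auto simp: orth_complement_def)
  have sW: "linear_subspace ?W"
    unfolding linear_subspace_def orth_complement_def
    using D E by (auto simp: add_left smult_left zero_left)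
  have dec: "\<exists>u\<in>U. \<exists>w\<in>?W. v = u + w" if v: "v \<in> V" for v
  proof -
    from split[OF v] obtain u where u: "u \<in> U" "v - u \<in> ?W" by blast
    moreover have "v = u + (v - u)" using D(1)[OF v] E(1)[OF u(1)] by (intro eq_vecI) auto
    ultimately show ?thesis by blast
  qed
  show "regular ?W"
    unfolding regular_def
  proof (intro conjI ballI impI sW)
    fix x assume x: "x \<in> ?W" and o: "\<forall>y\<in>?W. b x y = 0"
    have "b x y = 0" if "y \<in> V" for y
    proof -
      from dec[OF that] obtain u w where "u \<in> U" "w \<in> ?W" "y = u + w" by blast
      then show ?thesis using o x UV(2) D(1) E(1) W by (simp add: add_right)
    qed
    then show "x = 0\<^sub>v n" using V W[OF x] by (auto simp: regular_def)
  qed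
  have bij: "bij_betw (\<lambda>(u, v). u + v) (U \<times> ?W) V"
  proof (rule bij_betwI')
    fix p p' assume p: "p \<in> U \<times> ?W" and p': "p' \<in> U \<times> ?W"
    obtain u w where [simp]: "p = (u, w)" by (cases p)
    obtain u' w' where [simp]: "p' = (u', w')" by (cases p')
    have car: "u \<in> carrier_vec n" "u' \<in> carrier_vec n" "w \<in> carrier_vec n" "w' \<in> carrier_vec n"
      using p p' E(1) D(1) W by auto
    show "((case p of (u, v) \<Rightarrow> u + v) = (case p' of (u, v) \<Rightarrow> u + v)) = (p = p')"
    proof
      assume "(case p of (u, v) \<Rightarrow> u + v) = (case p' of (u, v) \<Rightarrow> u + v)"
      then have eq: "u + w = u' + w'" by simp
      have ix: "u $ i + w $ i = u' $ i + w' $ i" if "i < n" for i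
        using arg_cong[OF eq, of "\<lambda>v. v $ i"] that car by simp
      have d: "u + (-1) \<cdot>\<^sub>v u' = w' + (-1) \<cdot>\<^sub>v w"
        using car ix by (intro eq_vecI) (auto simp: algebra_simps)
      have "u + (-1) \<cdot>\<^sub>v u' \<in> U" using p p' E by auto
      moreover have "w' + (-1) \<cdot>\<^sub>v w \<in> ?W" using p p' linear_subspaceD[OF sW] by auto
      ultimately have z: "u + (-1) \<cdot>\<^sub>v u' = 0\<^sub>v n" using meet d by metis
      have "u $ i = u' $ i" if "i < n" for i
        using arg_cong[OF z, of "\<lambda>v. v $ i"] that car by simp
      then have uu: "u = u'" using car by (intro eq_vecI) auto
      then have "w = w'" using ix car by (intro eq_vecI) auto
      with uu show "p = p'" by simp
    qed auto
  next
    fix p assume "p \<in> U \<times> ?W"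
    then show "(case p of (u, v) \<Rightarrow> u + v) \<in> V" using D(3) U(2) W by auto
  next
    fix v assume "v \<in> V"
    then obtain u w where "u \<in> U" "w \<in> ?W" "v = u + w" using dec by blast
    then show "\<exists>p\<in>U \<times> ?W. v = (case p of (u, v) \<Rightarrow> u + v)"
      by (intro bexI[of _ "(u, w)"]) auto
  qed
  show "card V = card U * card ?W"
    using bij_betw_same_card[OF bij] by (simp add: card_cartesian_product)
  have q: "b (u + w) (u + w) = b u u + b w w" if "u \<in> U" "w \<in> ?W" for u w
    using that UV E(1) D(1) W by (simp add: add_left add_right)
  have "bij_betw (\<lambda>(u, v). u + v) (Sigma U (\<lambda>u. {w \<in> ?W. b w w = c - b u u})) {v \<in> V. b v v = c}"
  proof (rule bij_betw_imageI)
    show "inj_on (\<lambda>(u, v). u + v) (SIGMA u:U. {w \<in> ?W. b w w = c - b u u})"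
      by (rule inj_on_subset[OF bij_betw_imp_inj_on[OF bij]]) auto
    have "v \<in> (\<lambda>(u, v). u + v) ` (SIGMA u:U. {w \<in> ?W. b w w = c - b u u})"
      if "v \<in> V" "b v v = c" for v
      using dec[OF that(1)] q that(2) by force
    then show "(\<lambda>(u, v). u + v) ` (SIGMA u:U. {w \<in> ?W. b w w = c - b u u}) = {v \<in> V. b v v = c}"
      using q D(3) U(2) W by auto
  qed
  from bij_betw_same_card[OF this] have "representations V c =
      card (SIGMA u:U. {w \<in> ?W. b w w = c - b u u})"
    by (simp add: representations_def)
  also have "\<dots> = (\<Sum>u\<in>U. card {w \<in> ?W. b w w = c - b u u})"
    by (intro card_SigmaI ballI E(5)) (use linear_subspaceD(5)[OF sW] in simp)
  finally show "representations V c = (\<Sum>u\<in>U. representations ?W (c - b u u))"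
    by (simp add: representations_def)
qed

text \<open>
  The projection of \<open>v\<close> to the line of \<open>w\<close> is \<open>(b v w / b w w) w\<close>. This is completing the
  square.
\<close>

lemma split_off_line:
  assumes V: "regular V" and w: "w \<in> V" "b w w \<noteq> 0"
  obtains V' where "regular V'" "card V = CARD('a) * card V'"
    "\<And>c. representations V c = (\<Sum>x\<in>UNIV. representations V' (c - b w w * x^2))"
proof -
  have sV: "linear_subspace V" using V by (simp add: regular_def)
  note D = linear_subspaceD[OF sV]
  have wc: "w \<in> carrier_vec n" using D(1) w by simp
  let ?U = "(\<lambda>x. x \<cdot>\<^sub>v w) ` UNIV"
  have U: "linear_subspace ?U" unfolding linear_subspace_def
  proof (intro conjI ballI allI)
    show "0\<^sub>v n \<in> ?U" using wc by (intro image_eqI[of _ _ 0]) auto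
    show "x + y \<in> ?U" if "x \<in> ?U" "y \<in> ?U" for x y
      using that by (auto simp: add_smult_distrib_vec[symmetric])
    show "k \<cdot>\<^sub>v x \<in> ?U" if "x \<in> ?U" for x k
      using that by (auto simp: smult_smult_assoc)
  qed (use wc in auto)
  have UV: "?U \<subseteq> V" using w D(4) by auto
  have inj: "inj (\<lambda>x. x \<cdot>\<^sub>v w)"
  proof
    fix x y assume "x \<cdot>\<^sub>v w = y \<cdot>\<^sub>v w"
    then have "b (x \<cdot>\<^sub>v w) w = b (y \<cdot>\<^sub>v w) w" by simp
    then show "x = y" using w wc by (simp add: smult_left)
  qed
  have mem: "v \<in> orth_complement ?U V \<longleftrightarrow> v \<in> V \<and> b v w = 0" for v
  proof -
    have "b v w = 0" if "\<forall>u\<in>?U. b v u = 0" using bspec[OF that rangeI[of _ 1]] by simp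
    then show ?thesis using D(1) wc by (auto simp: orth_complement_def smult_right)
  qed
  have A: "\<exists>u\<in>?U. v - u \<in> orth_complement ?U V" if v: "v \<in> V" for v
  proof (rule bexI[of _ "(b v w / b w w) \<cdot>\<^sub>v w"])
    have vc: "v \<in> carrier_vec n" using D(1) v by simp
    have e: "v - (b v w / b w w) \<cdot>\<^sub>v w = v + (- (b v w / b w w)) \<cdot>\<^sub>v w"
      using vc wc by (intro eq_vecI) auto
    show "v - (b v w / b w w) \<cdot>\<^sub>v w \<in> orth_complement ?U V"
      unfolding e mem using v vc wc w D by (auto simp: add_left smult_left)
  qed auto
  have B: "u = 0\<^sub>v n" if "u \<in> ?U" "u \<in> orth_complement ?U V" for u
    using that wc w unfolding mem by (auto simp: smult_left)
  note S = orthogonal_splitting[OF V U UV A B]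
  show thesis
  proof (rule that[OF S(1)])
    show "card V = CARD('a) * card (orth_complement ?U V)"
      using S(2) by (simp add: card_image[OF inj])
    show "representations V c =
        (\<Sum>x\<in>UNIV. representations (orth_complement ?U V) (c - b w w * x^2))" for c
    proof -
      have "representations V c = (\<Sum>x\<in>UNIV. representations (orth_complement ?U V)
          (c - b (x \<cdot>\<^sub>v w) (x \<cdot>\<^sub>v w)))"
        using S(3)[of c] by (simp add: sum.reindex[OF inj])
      then show ?thesis
        using wc by (simp add: smult_left smult_right power2_eq_square ac_simps)
    qed
  qed (auto)
qed

text \<open>
  Two vectors with nonzero product span a plane on which an alternating form is nondegenerate. Splitting
  off such planes lowers the dimension by two until nothing is left.
\<close>

lemma alternating_even_dimension:
  assumes "regular V" "\<And>x. x \<in> V \<Longrightarrow> b x x = 0" "card V = CARD('a) ^ d"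
  shows "even d"
  using assms
proof (induction d arbitrary: V rule: less_induct)
  case (less d)
  have sV: "linear_subspace V" using less.prems by (simp add: regular_def)
  note D = linear_subspaceD[OF sV]
  have q: "CARD('a) > 1" by (rule card_field_gt_1)
  show ?case
  proof (cases "V = {0\<^sub>v n}")
    case True
    then have "CARD('a) ^ d = CARD('a) ^ 0" using less.prems(3) by simp
    then have "d = 0" using q by (simp only: power_inject_exp)
    then show ?thesis by simp
  next
    case False
    then obtain x where x: "x \<in> V" "x \<noteq> 0\<^sub>v n" using D(2) by blast
    then obtain y where y: "y \<in> V" "b x y \<noteq> 0" using less.prems(1) unfolding regular_def by blast
    have xc: "x \<in> carrier_vec n" and yc: "y \<in> carrier_vec n" using D(1) x y by auto
    have z: "b x x = 0" "b y y = 0" "b y x = b x y" using less.prems(2) x y sym[OF yc xc] by auto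
    \<comment> \<open>Pairing with \<open>y\<close> reads off the coefficient of \<open>x\<close>, and conversely.\<close>
    let ?f = "\<lambda>(s, t). s \<cdot>\<^sub>v x + t \<cdot>\<^sub>v y"
    let ?U = "?f ` UNIV"
    have fx: "b (?f p) x = snd p * b x y" "b (?f p) y = fst p * b x y" for p
      using xc yc z by (auto simp: add_left smult_left split: prod.split)
    have U: "linear_subspace ?U" unfolding linear_subspace_def
    proof (intro conjI ballI allI)
      show "0\<^sub>v n \<in> ?U" using xc yc by (intro image_eqI[of _ _ "(0, 0)"]) auto
      show "u + v \<in> ?U" if uv: "u \<in> ?U" "v \<in> ?U" for u v
      proof -
        obtain s t s' t' where "u = ?f (s, t)" "v = ?f (s', t')" using uv by auto
        then have "u + v = ?f (s + s', t + t')"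
          using xc yc by (intro eq_vecI) (auto simp: algebra_simps)
        then show ?thesis by blast
      qed
      show "k \<cdot>\<^sub>v u \<in> ?U" if u: "u \<in> ?U" for u k
      proof -
        obtain s t where "u = ?f (s, t)" using u by auto
        then have "k \<cdot>\<^sub>v u = ?f (k * s, k * t)"
          using xc yc by (intro eq_vecI) (auto simp: algebra_simps)
        then show ?thesis by blast
      qed
    qed (use xc yc in auto)
    have UV: "?U \<subseteq> V" using x y D(3,4) by auto
    have inj: "inj ?f"
    proof
      fix p p' assume "?f p = ?f p'"
      then have "snd p * b x y = snd p' * b x y" "fst p * b x y = fst p' * b x y"
        using fx by metis+
      then show "p = p'" using y by (simp add: prod_eq_iff)
    qed
    have mem: "v \<in> orth_complement ?U V \<longleftrightarrow> v \<in> V \<and> b v x = 0 \<and> b v y = 0" for v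
    proof -
      have "b v x = 0 \<and> b v y = 0" if v: "v \<in> V" and that: "\<forall>u\<in>?U. b v u = 0"
        using bspec[OF that rangeI[of _ "(1, 0)"]] bspec[OF that rangeI[of _ "(0, 1)"]] D(1)[OF v] xc yc
        by (simp add: add_right smult_right)
      then show ?thesis using D(1) xc yc by (auto simp: orth_complement_def smult_right add_right)
    qed
    have A: "\<exists>u\<in>?U. v - u \<in> orth_complement ?U V" if v: "v \<in> V" for v
    proof (rule bexI[of _ "?f (b v y / b x y, b v x / b x y)"])
      have vc: "v \<in> carrier_vec n" using D(1) v by simp
      have e: "v - ?f (s, t) = v + ((- s) \<cdot>\<^sub>v x + (- t) \<cdot>\<^sub>v y)" for s t
        using vc xc yc by (intro eq_vecI) auto
      show "v - ?f (b v y / b x y, b v x / b x y) \<in> orth_complement ?U V"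
        unfolding e mem using v vc xc yc x y z D by (auto simp: add_left smult_left)
    qed auto
    have B: "u = 0\<^sub>v n" if "u \<in> ?U" "u \<in> orth_complement ?U V" for u
    proof -
      from that(1) obtain p where p: "u = ?f p" by auto
      with that(2) fx[of p] y have "p = (0, 0)" unfolding mem by (simp add: prod_eq_iff)
      with p show ?thesis using xc yc by auto
    qed
    let ?W = "orth_complement ?U V"
    have V: "regular V" by fact
    note S = orthogonal_splitting[OF V U UV A B]
    have cU: "card ?U = CARD('a)^2"
      by (simp add: card_image[OF inj] card_prod power2_eq_square)
    have cV: "CARD('a) ^ d = CARD('a)^2 * card ?W" using S(2) cU less.prems(3) by simp
    have "card ?W > 0" using S(1) linear_subspaceD(2,5)[of ?W] by (auto simp: regular_def card_gt_0_iff)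
    then have "CARD('a) ^ 2 \<le> CARD('a) ^ d" using cV by simp
    then have d: "d \<ge> 2" using q power_le_imp_le_exp by blast
    then have "CARD('a) ^ d = CARD('a)^2 * CARD('a) ^ (d - 2)"
      by (metis le_add_diff_inverse power_add)
    with cV q have "card ?W = CARD('a) ^ (d - 2)" by simp
    then have "even (d - 2)"
      using less.IH[of "d - 2" ?W] S(1) d less.prems(2) by (auto simp: mem)
    with d show ?thesis by simp
  qed
qed


lemma anisotropic_vector_odd:
  assumes "regular V" "card V = CARD('a) ^ d" "odd d"
  obtains w where "w \<in> V" "b w w \<noteq> 0"
  using alternating_even_dimension[of V d] assms by blast

lemma split_off_line_dimension:
  assumes V: "regular V" "card V = CARD('a) ^ d" and w: "w \<in> V" "b w w \<noteq> 0"
  obtains V' where "regular V'" "d > 0" "card V' = CARD('a) ^ (d - 1)"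
    "\<And>c. representations V c = (\<Sum>x\<in>UNIV. representations V' (c - b w w * x^2))"
proof -
  obtain V' where V': "regular V'" "card V = CARD('a) * card V'"
    "\<And>c. representations V c = (\<Sum>x\<in>UNIV. representations V' (c - b w w * x^2))"
    using split_off_line[OF V(1) w] by blast
  have d: "d > 0" using V(2) V'(2) card_field_gt_1[where 'a='a] by (cases d) auto
  then have "CARD('a) ^ d = CARD('a) * CARD('a) ^ (d - 1)" by (cases d) auto
  then have "card V' = CARD('a) ^ (d - 1)" using V(2) V'(2) by simp
  then show thesis using that V' d by blast
qed

text \<open>
  Either no nonzero value is taken at all, or two lines split off, the second because the complement of
  the first has odd dimension. By induction, how often the remaining form represents a field element
  depends only on whether that element is zero. So the count for \<open>c\<close> depends on \<open>c\<close> only through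
  the number of solutions of \<open>a x\<^sup>2 + b y\<^sup>2 = c\<close>.
\<close>

lemma representations_even:
  assumes "regular V" "card V = CARD('a) ^ d" "even d" "c \<noteq> 0" "c' \<noteq> 0"
  shows "representations V c = representations V c'"
  using assms
proof (induction d arbitrary: V c c' rule: less_induct)
  case (less d)
  show ?case
  proof (cases "\<forall>x\<in>V. b x x = 0")
    case True
    then have "representations V k = 0" if "k \<noteq> 0" for k
      using that by (auto simp: representations_def card_eq_0_iff)
    then show ?thesis using less.prems(4,5) by simp
  next
    case False
    then obtain w where w: "w \<in> V" "b w w \<noteq> 0" by blast
    obtain V' where V': "regular V'" "d > 0" "card V' = CARD('a) ^ (d - 1)"
      and r': "\<And>c. representations V c = (\<Sum>x\<in>UNIV. representations V' (c - b w w * x^2))"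
      using split_off_line_dimension[OF less.prems(1,2) w] by blast
    have odd: "odd (d - 1)" using V'(2) less.prems(3) by simp
    obtain w' where w': "w' \<in> V'" "b w' w' \<noteq> 0"
      using anisotropic_vector_odd[OF V'(1,3) odd] by blast
    obtain V'' where V'': "regular V''" "card V'' = CARD('a) ^ (d - 1 - 1)"
      and r'': "\<And>c. representations V' c = (\<Sum>x\<in>UNIV. representations V'' (c - b w' w' * x^2))"
      using split_off_line_dimension[OF V'(1,3) w'] by blast
    have flat: "representations V'' t = representations V'' 1" if "t \<noteq> 0" for t
      by (rule less.IH[OF _ V'']) (use that V'(2) less.prems(3) in auto)
    let ?S = "\<lambda>k. {(x, y). b w w * x^2 + b w' w' * y^2 = k}"
    have r: "representations V k =
        card (?S k) * representations V'' 0 + card (- ?S k) * representations V'' 1" for k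
    proof -
      have "representations V k =
          (\<Sum>(x, y)\<in>UNIV. representations V'' (k - b w w * x^2 - b w' w' * y^2))"
        unfolding r' r'' sum.cartesian_product UNIV_Times_UNIV ..
      also have "\<dots> = (\<Sum>p\<in>UNIV. if p \<in> ?S k then representations V'' 0 else representations V'' 1)"
        by (rule sum.cong) (auto simp: algebra_simps intro!: flat)
      also have "\<dots> = card (?S k) * representations V'' 0 + card (- ?S k) * representations V'' 1"
        by (subst sum.If_cases) auto
      finally show ?thesis .
    qed
    have "card (?S c) = card (?S c')"
      using binary_form_representations[OF w(2) w'(2) less.prems(4,5)] .
    moreover from this have "card (- ?S c) = card (- ?S c')"
      by (simp add: Compl_eq_Diff_UNIV card_Diff_subset)
    ultimately show ?thesis unfolding r by simp
  qed
qed

text \<open>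
  After splitting off the line of \<open>w\<close>, the isotropic vectors are counted by summing over \<open>x\<close> how
  often the even-dimensional complement represents \<open>- b w w x\<^sup>2\<close>. That number depends only on
  whether \<open>x\<close> is zero, so it may be replaced by how often \<open>x\<close> itself is represented, and the sum
  becomes the number of all vectors of the complement.
\<close>

lemma isotropic_count_odd:
  assumes V: "regular V" "card V = CARD('a) ^ d" "odd d"
  shows "card {v \<in> V. b v v = 0} = CARD('a) ^ (d - 1)"
proof -
  obtain w where w: "w \<in> V" "b w w \<noteq> 0" using anisotropic_vector_odd[OF V] .
  obtain V' where V': "regular V'" "card V' = CARD('a) ^ (d - 1)"
    and r: "\<And>c. representations V c = (\<Sum>x\<in>UNIV. representations V' (c - b w w * x^2))"
    using split_off_line_dimension[OF V(1,2) w] by blast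
  have "representations V 0 = (\<Sum>x\<in>UNIV. representations V' x)"
    unfolding r
  proof (rule sum.cong[OF refl])
    fix x
    show "representations V' (0 - b w w * x^2) = representations V' x"
    proof (cases "x = 0")
      case False
      then show ?thesis
        by (intro representations_even[OF V']) (use V(3) w(2) in auto)
    qed simp
  qed
  also have "\<dots> = card V'" using sum_representations V'(1) by (simp add: regular_def)
  finally show ?thesis using V'(2) by (simp add: representations_def)
qed

end

section \<open>Bordered symmetric matrices\<close>

lemma finite_carrier_mat: "finite (carrier_mat m n :: 'a::finite mat set)"
proof (rule finite_subset)
  show "carrier_mat m n \<subseteq> mat m n ` (({0..<m} \<times> {0..<n}) \<rightarrow>\<^sub>E (UNIV :: 'a set))"
  proof
    fix A :: "'a mat" assume "A \<in> carrier_mat m n"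
    then have e: "A = mat m n (restrict (($$) A) ({0..<m} \<times> {0..<n}))"
      by (intro eq_matI) auto
    show "A \<in> mat m n ` (({0..<m} \<times> {0..<n}) \<rightarrow>\<^sub>E UNIV)"
      by (rule image_eqI[where f = "mat m n", OF e]) auto
  qed
qed (intro finite_imageI finite_PiE, auto)

lemma invertible_mat_iff_det_nonzero:
  fixes A :: "'a::field mat"
  assumes A: "A \<in> carrier_mat n n"
  shows "invertible_mat A \<longleftrightarrow> det A \<noteq> 0"
proof
  assume "invertible_mat A"
  then obtain B where B: "A * B = 1\<^sub>m n" "B * A = 1\<^sub>m (dim_row B)"
    using A by (auto simp: invertible_mat_def inverts_mat_def)
  have "dim_col B = n" using arg_cong[OF B(1), of dim_col] by simp
  moreover have "dim_row B = n" using arg_cong[OF B(2), of dim_col] A by simp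
  ultimately have "B \<in> carrier_mat n n" by auto
  from det_mult[OF A this] B(1) show "det A \<noteq> 0" by auto
next
  assume "det A \<noteq> 0"
  from det_non_zero_imp_unit[OF A this, of "()"]
  obtain B where "B * A = 1\<^sub>m n" "A * B = 1\<^sub>m n" "B \<in> carrier_mat n n"
    unfolding Units_def ring_mat_def by auto
  then show "invertible_mat A"
    using A by (auto simp: invertible_mat_def inverts_mat_def)
qed

lemma det_nonzero_bij_betw:
  fixes B :: "'a::{field,finite} mat"
  assumes B: "B \<in> carrier_mat n n" and d: "det B \<noteq> 0"
  shows "bij_betw (\<lambda>w. B *\<^sub>v w) (carrier_vec n) (carrier_vec n)"
proof -
  have inj: "inj_on (\<lambda>w. B *\<^sub>v w) (carrier_vec n)"
  proof (rule inj_onI)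
    fix v w assume v: "v \<in> carrier_vec n" and w: "w \<in> carrier_vec n" and e: "B *\<^sub>v v = B *\<^sub>v w"
    have "B *\<^sub>v (v - w) = 0\<^sub>v n"
      using B v w e by (simp add: mult_minus_distrib_mat_vec)
    then have z: "v - w = 0\<^sub>v n"
      using det_0_iff_vec_prod_zero[OF B] d v w by (meson minus_carrier_vec)
    have "v $ i = w $ i" if "i < n" for i
      using arg_cong[OF z, of "\<lambda>v. v $ i"] that v w by simp
    then show "v = w" using v w by (intro eq_vecI) auto
  qed
  moreover have "(\<lambda>w. B *\<^sub>v w) ` carrier_vec n = carrier_vec n"
    using card_carrier_vec[of n, where 'a='a] inj B
    by (intro endo_inj_surj) auto
  ultimately show ?thesis by (simp add: bij_betw_def)
qed

lemma isotropic_count_symmetric_matrix: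
  fixes B :: "'a::{field,finite} mat"
  assumes B: "B \<in> carrier_mat n n" "transpose_mat B = B" "det B \<noteq> 0" and n: "odd n"
  shows "card {w \<in> carrier_vec n. w \<bullet> (B *\<^sub>v w) = 0} = CARD('a) ^ (n - 1)"
proof -
  have sym: "x \<bullet> (B *\<^sub>v y) = y \<bullet> (B *\<^sub>v x)" if x: "x \<in> carrier_vec n" and y: "y \<in> carrier_vec n" for x y
  proof -
    have "row B i = col B i" if "i < n" for i
      using row_transpose[of i B] B(1,2) that by simp
    then have "B *\<^sub>v x = vec n (\<lambda>j. x \<bullet> col B j)"
      using B(1) x by (intro eq_vecI) (auto intro!: comm_scalar_prod)
    then have "(B *\<^sub>v x) \<bullet> y = x \<bullet> (B *\<^sub>v y)"
      using assoc_scalar_prod[OF x B(1) y] B(1) by (simp add: mult_mat_vec_def)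
    moreover have "(B *\<^sub>v x) \<bullet> y = y \<bullet> (B *\<^sub>v x)"
      using B(1) x y by (intro comm_scalar_prod[of _ n]) auto
    ultimately show ?thesis by simp
  qed
  interpret symmetric_form n "\<lambda>x y. x \<bullet> (B *\<^sub>v y)"
  proof
    fix x y z :: "'a vec" and k :: 'a
    assume x: "x \<in> carrier_vec n" and y: "y \<in> carrier_vec n"
    show "(k \<cdot>\<^sub>v x) \<bullet> (B *\<^sub>v y) = k * (x \<bullet> (B *\<^sub>v y))"
      using B(1) x y by (intro smult_scalar_prod_distrib[of _ n]) auto
    show "x \<bullet> (B *\<^sub>v y) = y \<bullet> (B *\<^sub>v x)" by (rule sym[OF x y])
    assume z: "z \<in> carrier_vec n"
    show "(x + y) \<bullet> (B *\<^sub>v z) = x \<bullet> (B *\<^sub>v z) + y \<bullet> (B *\<^sub>v z)"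
      using B(1) x y z by (intro add_scalar_prod_distrib[of _ n]) auto
  qed
  have "regular (carrier_vec n)"
    unfolding regular_def linear_subspace_def
  proof (intro conjI ballI impI allI)
    fix x :: "'a vec" assume x: "x \<in> carrier_vec n" and o: "\<forall>y\<in>carrier_vec n. x \<bullet> (B *\<^sub>v y) = 0"
    have "(B *\<^sub>v x) $ i = 0" if i: "i < n" for i
      using bspec[OF o, of "unit_vec n i"] sym[OF x, of "unit_vec n i"] i B(1) x
      by simp
    then have "B *\<^sub>v x = 0\<^sub>v n" using B(1) by (intro eq_vecI) auto
    then show "x = 0\<^sub>v n" using det_0_iff_vec_prod_zero[OF B(1)] B(3) x by blast
  qed auto
  from isotropic_count_odd[OF this _ n] card_carrier_vec[of n, where 'a='a]
  show ?thesis by simp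
qed

definition border :: "'a \<Rightarrow> 'a vec \<Rightarrow> 'a mat \<Rightarrow> 'a mat" where
  "border c v B = mat (Suc (dim_vec v)) (Suc (dim_vec v)) (\<lambda>(i, j).
     case i of 0 \<Rightarrow> (case j of 0 \<Rightarrow> c | Suc j' \<Rightarrow> v $ j')
     | Suc i' \<Rightarrow> (case j of 0 \<Rightarrow> v $ i' | Suc j' \<Rightarrow> B $$ (i', j')))"

context
  fixes m :: nat and v :: "'a::field vec" and B :: "'a mat"
  assumes v: "v \<in> carrier_vec m" and B: "B \<in> carrier_mat m m"
begin

lemma border_carrier: "border c v B \<in> carrier_mat (Suc m) (Suc m)"
  using v by (simp add: border_def)

lemma border_index:
  "border c v B $$ (0, 0) = c"
  "i < m \<Longrightarrow> border c v B $$ (Suc i, 0) = v $ i"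
  "i < m \<Longrightarrow> border c v B $$ (0, Suc i) = v $ i"
  "i < m \<Longrightarrow> j < m \<Longrightarrow> border c v B $$ (Suc i, Suc j) = B $$ (i, j)"
  using v by (auto simp: border_def)

lemma border_symmetric: "transpose_mat (border c v B) = border c v B \<longleftrightarrow> transpose_mat B = B"
proof
  assume s: "transpose_mat (border c v B) = border c v B"
  have "transpose_mat B $$ (i, j) = B $$ (i, j)" if "i < m" "j < m" for i j
    using arg_cong[OF s, of "\<lambda>A. A $$ (Suc i, Suc j)"] that B border_carrier[of c]
    by (auto simp: border_index)
  then show "transpose_mat B = B" using B by (intro eq_matI) auto
next
  assume s: "transpose_mat B = B"
  have "B $$ (j, i) = B $$ (i, j)" if "i < m" "j < m" for i j
    using arg_cong[OF s, of "\<lambda>A. A $$ (i, j)"] that B by simp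
  then show "transpose_mat (border c v B) = border c v B"
    using v by (intro eq_matI) (auto simp: border_def split: nat.split)
qed

lemma border_mult_vec:
  assumes y: "y \<in> carrier_vec m"
  shows "border c v B *\<^sub>v vCons t y = vCons (c * t + v \<bullet> y) (t \<cdot>\<^sub>v v + B *\<^sub>v y)"
proof -
  have r0: "row (border c v B) 0 = vCons c v"
    using v by (intro eq_vecI) (auto simp: border_def vec_index_vCons split: nat.split)
  have rS: "row (border c v B) (Suc i) = vCons (v $ i) (row B i)" if "i < m" for i
    using v B that by (intro eq_vecI) (auto simp: border_def vec_index_vCons split: nat.split)
  show ?thesis
  proof (rule eq_vecI)
    fix i assume "i < dim_vec (vCons (c * t + v \<bullet> y) (t \<cdot>\<^sub>v v + B *\<^sub>v y))"
    then show "(border c v B *\<^sub>v vCons t y) $ i = vCons (c * t + v \<bullet> y) (t \<cdot>\<^sub>v v + B *\<^sub>v y) $ i"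
      using v B y border_carrier[of c] by (cases i) (auto simp: r0 rS)
  qed (use v B border_carrier[of c] in auto)
qed

text \<open>
  In the expansion along the first column no cofactor involves \<open>c\<close>.
\<close>

lemma det_border: "det (border c v B) = c * det B + det (border 0 v B)"
proof -
  have del: "mat_delete (border c v B) i 0 = mat_delete (border 0 v B) i 0" if "i < Suc m" for i
    using v by (intro eq_matI) (auto simp: mat_delete_def border_def split: nat.split)
  then have cof: "cofactor (border c v B) i 0 = cofactor (border 0 v B) i 0" if "i < Suc m" for i
    using that by (simp add: cofactor_def)
  have "mat_delete (border c v B) 0 0 = B" for c
    using v B by (intro eq_matI) (auto simp: mat_delete_def border_def)
  then have cof0: "cofactor (border c v B) 0 0 = det B" for c by (simp add: cofactor_def)
  have "det (border c v B) =
      c * det B + (\<Sum>i<m. v $ i * cofactor (border c v B) (Suc i) 0)" for c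
    unfolding laplace_expansion_column[OF border_carrier zero_less_Suc] sum.lessThan_Suc_shift
    by (simp add: border_index cof0)
  moreover have "(\<Sum>i<m. v $ i * cofactor (border c v B) (Suc i) 0) =
      (\<Sum>i<m. v $ i * cofactor (border 0 v B) (Suc i) 0)"
    by (rule sum.cong[OF refl], subst cof) auto
  ultimately show ?thesis by simp
qed

end

text \<open>
  The value of \<open>c\<close> for which the bordered matrix is singular can be read off a kernel vector
  \<open>(1, - w)\<close>; affine dependence on \<open>c\<close> does the rest. Writing the border as \<open>B w\<close> avoids the
  inverse of \<open>B\<close>.
\<close>

lemma det_border_image:
  fixes B :: "'a::field mat"
  assumes w: "w \<in> carrier_vec m" and B: "B \<in> carrier_mat m m"
  shows "det (border c (B *\<^sub>v w) B) = (c - w \<bullet> (B *\<^sub>v w)) * det B"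
proof -
  let ?v = "B *\<^sub>v w" and ?c = "w \<bullet> (B *\<^sub>v w)"
  have v: "?v \<in> carrier_vec m" using B w by simp
  have "border ?c ?v B *\<^sub>v vCons 1 (- w) = vCons (?c + ?v \<bullet> (- w)) (1 \<cdot>\<^sub>v ?v + B *\<^sub>v (- w))"
    using border_mult_vec[OF v B, of "- w"] w by simp
  also have "?v \<bullet> (- w) = - ?c"
    using v w comm_scalar_prod[OF v w] scalar_prod_uminus_right[of ?v w] B by simp
  also have "1 \<cdot>\<^sub>v ?v + B *\<^sub>v (- w) = 0\<^sub>v m"
    using B w v by (intro eq_vecI) auto
  finally have "border ?c ?v B *\<^sub>v vCons 1 (- w) = 0\<^sub>v (Suc m)" by (simp add: zero_vec_Suc)
  moreover have "vCons 1 (- w) \<in> carrier_vec (Suc m)" "vCons 1 (- w) \<noteq> 0\<^sub>v (Suc m)"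
    using w by (auto simp: zero_vec_Suc)
  ultimately have "det (border ?c ?v B) = 0"
    using det_0_iff_vec_prod_zero[OF border_carrier[OF v B]] by blast
  then have "det (border 0 ?v B) = - ?c * det B"
    using det_border[OF v B, of ?c] by (simp add: eq_neg_iff_add_eq_0 add.commute)
  then show ?thesis using det_border[OF v B, of c] by (simp add: algebra_simps)
qed

lemma border_cases:
  fixes A :: "'a::field mat"
  assumes A: "A \<in> carrier_mat (Suc m) (Suc m)" "transpose_mat A = A"
  obtains c v B where "v \<in> carrier_vec m" "B \<in> carrier_mat m m" "A = border c v B"
proof
  let ?v = "vec m (\<lambda>i. A $$ (0, Suc i))" and ?B = "mat m m (\<lambda>(i, j). A $$ (Suc i, Suc j))"
  have s: "A $$ (j, i) = A $$ (i, j)" if "i < Suc m" "j < Suc m" for i j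
    using arg_cong[OF A(2), of "\<lambda>A. A $$ (i, j)"] that A(1) by simp
  show "A = border (A $$ (0, 0)) ?v ?B"
    using A(1) s by (intro eq_matI) (auto simp: border_def split: nat.split)
qed auto

lemma border_inject:
  assumes "v \<in> carrier_vec m" "B \<in> carrier_mat m m" "v' \<in> carrier_vec m" "B' \<in> carrier_mat m m"
    and e: "border c v B = border c' v' B'"
  shows "c = c' \<and> v = v' \<and> B = B'"
proof -
  have "v $ i = v' $ i" if "i < m" for i
    using arg_cong[OF e, of "\<lambda>A. A $$ (0, Suc i)"] assms(1-4) that by (simp add: border_def)
  moreover have "B $$ (i, j) = B' $$ (i, j)" if "i < m" "j < m" for i j
    using arg_cong[OF e, of "\<lambda>A. A $$ (Suc i, Suc j)"] assms(1-4) that by (simp add: border_def)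
  moreover have "c = c'"
    using arg_cong[OF e, of "\<lambda>A. A $$ (0, 0)"] by (simp add: border_def)
  ultimately show ?thesis using assms(1-4) by auto
qed

text \<open>
  For singular \<open>B\<close> the corner does not matter. For invertible \<open>B\<close> substitute \<open>v = B w\<close>: on the
  left exactly one corner is excluded for each \<open>w\<close>, on the right the isotropic vectors of \<open>B\<close> are
  excluded. Odd size is what makes these numbers proportional.
\<close>

lemma border_count:
  fixes B :: "'a::{field,finite} mat"
  assumes B: "B \<in> carrier_mat m m" "transpose_mat B = B" and m: "odd m"
  shows "card {(c, v). v \<in> carrier_vec m \<and> det (border c v B) \<noteq> 0} =
    CARD('a) * card {v \<in> carrier_vec m. det (border 0 v B) \<noteq> 0}"
proof (cases "det B = 0")
  case True
  define P where "P c v \<longleftrightarrow> v \<in> carrier_vec m \<and> det (border c v B) \<noteq> 0" for c v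
  have "P c v \<longleftrightarrow> P 0 v" for c v
    using det_border[OF _ B(1), of v c] True by (auto simp: P_def)
  then have "{(c, v). P c v} = UNIV \<times> {v. P 0 v}" by blast
  then show ?thesis by (simp add: card_cartesian_product P_def)
next
  case False
  let ?C = "carrier_vec m :: 'a vec set" and ?Q = "\<lambda>w. w \<bullet> (B *\<^sub>v w)"
  note C = card_carrier_vec[of m, where 'a='a]
  have bij: "bij_betw (\<lambda>w. B *\<^sub>v w) ?C ?C" by (rule det_nonzero_bij_betw[OF B(1) False])
  have "bij_betw (\<lambda>w. B *\<^sub>v w) {w \<in> ?C. ?Q w \<noteq> 0} {v \<in> ?C. det (border 0 v B) \<noteq> 0}"
    by (rule bij_betw_Collect[OF bij]) (use False in \<open>simp add: det_border_image[OF _ B(1)]\<close>)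
  then have "card {v \<in> ?C. det (border 0 v B) \<noteq> 0} = card {w \<in> ?C. ?Q w \<noteq> 0}"
    by (simp add: bij_betw_same_card)
  also have "{w \<in> ?C. ?Q w \<noteq> 0} = ?C - {w \<in> ?C. ?Q w = 0}" by auto
  also have "card \<dots> = CARD('a) ^ m - CARD('a) ^ (m - 1)"
    using C isotropic_count_symmetric_matrix[OF B False m] by (subst card_Diff_subset) auto
  finally have r: "card {v \<in> ?C. det (border 0 v B) \<noteq> 0} = CARD('a) ^ m - CARD('a) ^ (m - 1)" .
  have bij': "bij_betw (map_prod id (\<lambda>w. B *\<^sub>v w)) ((UNIV :: 'a set) \<times> ?C) (UNIV \<times> ?C)"
    by (rule bij_betw_map_prod[OF bij_betw_id bij])
  have "bij_betw (map_prod id (\<lambda>w. B *\<^sub>v w)) {p \<in> UNIV \<times> ?C. fst p \<noteq> ?Q (snd p)}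
      {p \<in> UNIV \<times> ?C. det (border (fst p) (snd p) B) \<noteq> 0}"
    by (rule bij_betw_Collect[OF bij']) (use False in \<open>auto simp: det_border_image[OF _ B(1)]\<close>)
  then have "card {p \<in> UNIV \<times> ?C. det (border (fst p) (snd p) B) \<noteq> 0} =
      card {p \<in> UNIV \<times> ?C. fst p \<noteq> ?Q (snd p)}"
    by (simp add: bij_betw_same_card)
  also have "{p \<in> UNIV \<times> ?C. fst p \<noteq> ?Q (snd p)} = UNIV \<times> ?C - (\<lambda>w. (?Q w, w)) ` ?C" by auto
  also have "card \<dots> = card ((UNIV :: 'a set) \<times> ?C) - card ((\<lambda>w. (?Q w, w)) ` ?C)"
    using C by (intro card_Diff_subset) auto
  also have "\<dots> = CARD('a) * CARD('a) ^ m - CARD('a) ^ m"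
    using C by (simp add: card_cartesian_product card_image inj_on_def)
  also have "\<dots> = CARD('a) * (CARD('a) ^ m - CARD('a) ^ (m - 1))"
    using m by (cases m) (auto simp: diff_mult_distrib2)
  also have "{p \<in> UNIV \<times> ?C. det (border (fst p) (snd p) B) \<noteq> 0} =
      {(c, v). v \<in> ?C \<and> det (border c v B) \<noteq> 0}" by auto
  finally show ?thesis using r by simp
qed

section \<open>Imposing zeros on the diagonal\<close>

definition zero_diagonal_on :: "nat \<Rightarrow> nat set \<Rightarrow> 'a::{field,finite} mat set" where
  "zero_diagonal_on n Z = {A \<in> carrier_mat n n. transpose_mat A = A \<and> det A \<noteq> 0 \<and>
     (\<forall>i<n. i \<in> Z \<longrightarrow> A $$ (i, i) = 0)}"

lemma finite_zero_diagonal_on: "finite (zero_diagonal_on n Z :: 'a::{field,finite} mat set)"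
  by (rule finite_subset[OF _ finite_carrier_mat[of n n]]) (auto simp: zero_diagonal_on_def)

lemma sym_inv_mats_eq: "sym_inv_mats F n = zero_diagonal_on n {}"
  by (auto simp: sym_inv_mats_def zero_diagonal_on_def invertible_mat_iff_det_nonzero)

text \<open>
  Grouping by the block that remains when the first row and column are removed. Conditions on later
  diagonal entries concern only the block, a condition on the first entry only the corner.
\<close>

lemma card_zero_diagonal_on_Suc:
  "card (zero_diagonal_on (Suc m) Z :: 'a::{field,finite} mat set) =
    (\<Sum>B | B \<in> carrier_mat m m \<and> transpose_mat B = B \<and> (\<forall>i<m. Suc i \<in> Z \<longrightarrow> B $$ (i, i) = 0).
      card {(c, v). v \<in> carrier_vec m \<and> det (border c v B) \<noteq> (0 :: 'a) \<and> (0 \<in> Z \<longrightarrow> c = 0)})"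
proof -
  let ?S = "{B :: 'a mat. B \<in> carrier_mat m m \<and> transpose_mat B = B \<and>
    (\<forall>i<m. Suc i \<in> Z \<longrightarrow> B $$ (i, i) = 0)}"
  let ?T = "\<lambda>B :: 'a mat. {(c, v). v \<in> carrier_vec m \<and> det (border c v B) \<noteq> 0 \<and> (0 \<in> Z \<longrightarrow> c = 0)}"
  let ?f = "\<lambda>(B, c, v). border c v B :: 'a mat"
  have mem: "border c v B \<in> zero_diagonal_on (Suc m) Z \<longleftrightarrow> (B, c, v) \<in> Sigma ?S ?T"
    if "v \<in> carrier_vec m" "B \<in> carrier_mat m m" for c v and B :: "'a mat"
    using that border_carrier[OF that] border_symmetric[OF that] border_index[OF that]
    by (auto simp: zero_diagonal_on_def All_less_Suc2)
  have "bij_betw ?f (Sigma ?S ?T) (zero_diagonal_on (Suc m) Z)"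
  proof (rule bij_betw_imageI)
    show "inj_on ?f (Sigma ?S ?T)"
    proof (rule inj_onI, clarify, goal_cases)
      case (1 B c v B' c' v')
      then show ?case using border_inject[of v m B v' B' c c'] by blast
    qed
    show "?f ` Sigma ?S ?T = zero_diagonal_on (Suc m) Z"
    proof
      show "?f ` Sigma ?S ?T \<subseteq> zero_diagonal_on (Suc m) Z"
      proof (rule image_subsetI)
        fix p assume p: "p \<in> Sigma ?S ?T"
        obtain B c v where e: "p = (B, c, v)" by (cases p)
        with p have "v \<in> carrier_vec m" "B \<in> carrier_mat m m" by auto
        from mem[OF this, of c] p e show "?f p \<in> zero_diagonal_on (Suc m) Z" by simp
      qed
      show "zero_diagonal_on (Suc m) Z \<subseteq> ?f ` Sigma ?S ?T"
      proof
        fix A :: "'a mat" assume A: "A \<in> zero_diagonal_on (Suc m) Z"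
        then have "A \<in> carrier_mat (Suc m) (Suc m)" "transpose_mat A = A"
          by (simp_all add: zero_diagonal_on_def)
        then obtain c v B where b: "v \<in> carrier_vec m" "B \<in> carrier_mat m m" "A = border c v B"
          using border_cases by blast
        have "(B, c, v) \<in> Sigma ?S ?T" using mem[OF b(1,2), of c] A unfolding b(3) by blast
        moreover have "A = ?f (B, c, v)" by (simp add: b(3))
        ultimately show "A \<in> ?f ` Sigma ?S ?T" by (rule rev_image_eqI)
      qed
    qed
  qed
  from bij_betw_same_card[OF this]
  have "card (zero_diagonal_on (Suc m) Z :: 'a mat set) = card (Sigma ?S ?T)" by simp
  also have "\<dots> = (\<Sum>B\<in>?S. card (?T B))"
  proof (intro card_SigmaI ballI)
    show "finite ?S" by (rule finite_subset[OF _ finite_carrier_mat[of m m]]) blast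
    have "finite ((UNIV :: 'a set) \<times> (carrier_vec m :: 'a vec set))"
      using card_carrier_vec[of m, where 'a='a] by simp
    then show "finite (?T B)" for B by (rule rev_finite_subset) blast
  qed
  finally show ?thesis .
qed

lemma card_zero_diagonal_on_0:
  assumes m: "odd m" and Z: "0 \<notin> Z"
  shows "card (zero_diagonal_on (Suc m) Z :: 'a::{field,finite} mat set) =
    CARD('a) * card (zero_diagonal_on (Suc m) (insert 0 Z) :: 'a mat set)"
proof -
  have zero: "card {(c, v). v \<in> carrier_vec m \<and> det (border c v B) \<noteq> 0 \<and> c = 0} =
      card {v \<in> carrier_vec m. det (border 0 v B) \<noteq> 0}" for B :: "'a mat"
    by (rule bij_betw_same_card[symmetric, of "Pair 0"])
      (auto simp: bij_betw_def inj_on_def)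
  show ?thesis
    unfolding card_zero_diagonal_on_Suc sum_distrib_left
    by (rule sum.cong) (use Z in \<open>auto simp: zero border_count m\<close>)
qed

text \<open>
  Simultaneous permutation of rows and columns preserves symmetry and invertibility; it moves any
  diagonal position to the corner.
\<close>

lemma card_zero_diagonal_on_permute:
  assumes p: "p permutes {0..<n}" and pp: "\<And>i. p (p i) = i"
  shows "card (zero_diagonal_on n (p ` Z) :: 'a::{field,finite} mat set) =
    card (zero_diagonal_on n Z :: 'a mat set)"
proof -
  let ?f = "\<lambda>A::'a mat. mat n n (\<lambda>(i, j). A $$ (p i, p j))"
  have lt: "p i < n \<longleftrightarrow> i < n" for i using permutes_in_image[OF p, of i] by simp
  have det: "det (?f A) \<noteq> 0" if A: "A \<in> carrier_mat n n" "det A \<noteq> 0" for A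
  proof -
    define R where "R = mat n n (\<lambda>(i, j). A $$ (p i, j))"
    define T where "T = mat n n (\<lambda>(i, j). transpose_mat R $$ (p i, j))"
    have "det R = signof p * det A" unfolding R_def by (rule det_permute_rows[OF A(1) p])
    moreover have "det T = signof p * det (transpose_mat R)"
      unfolding T_def by (rule det_permute_rows[OF _ p]) (simp add: R_def)
    moreover have "det (transpose_mat R) = det R" by (rule det_transpose[of _ n]) (simp add: R_def)
    moreover have "transpose_mat T = ?f A"
      by (rule eq_matI) (auto simp: T_def R_def lt)
    moreover have "det (transpose_mat T) = det T" by (rule det_transpose[of _ n]) (simp add: T_def)
    moreover have "(signof p :: 'a) \<noteq> 0" by (simp add: sign_def)
    ultimately show ?thesis using A(2) by simp
  qed
  have map: "?f A \<in> zero_diagonal_on n (p ` X)" if A: "A \<in> zero_diagonal_on n X" for A X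
  proof -
    have "A $$ (j, i) = A $$ (i, j)" if "i < n" "j < n" for i j
      using A that index_transpose_mat(1)[of i A j] by (auto simp: zero_diagonal_on_def)
    then show ?thesis using A det[of A]
      by (auto simp: zero_diagonal_on_def lt pp intro!: eq_matI)
  qed
  have inv: "?f (?f A) = A" if "A \<in> carrier_mat n n" for A
    using that by (intro eq_matI) (auto simp: lt pp)
  have "bij_betw ?f (zero_diagonal_on n Z) (zero_diagonal_on n (p ` Z))"
  proof (rule bij_betw_byWitness[where f' = ?f])
    show "?f ` zero_diagonal_on n (p ` Z) \<subseteq> zero_diagonal_on n Z"
      using map[of _ "p ` Z"] by (auto simp: image_image pp)
  qed (use map inv in \<open>auto simp: zero_diagonal_on_def\<close>)
  from bij_betw_same_card[OF this] show ?thesis by simp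
qed

text \<open>
  Each diagonal condition divides the count by the size of the field. Evenness of the size enters
  through \<open>border_count\<close>, whose block has one row less.
\<close>

lemma card_zero_diagonal_on_insert:
  assumes n: "even n" and k: "k < n" "k \<notin> Z"
  shows "card (zero_diagonal_on n Z :: 'a::{field,finite} mat set) =
    CARD('a) * card (zero_diagonal_on n (insert k Z) :: 'a mat set)"
proof -
  define p where "p = Transposition.transpose 0 k"
  have p: "p permutes {0..<n}" unfolding p_def by (rule permutes_swap_id) (use k in auto)
  have pp: "p (p i) = i" for i by (simp add: p_def)
  have pk: "p k = 0" by (simp add: p_def)
  have Z: "0 \<notin> p ` Z" using k(2) pp pk by (metis imageE)
  obtain m where m: "n = Suc m" using k by (cases n) auto
  have "card (zero_diagonal_on n (p ` Z) :: 'a mat set) =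
      CARD('a) * card (zero_diagonal_on n (p ` insert k Z) :: 'a mat set)"
    using card_zero_diagonal_on_0[of m "p ` Z", where 'a='a] n Z pk by (simp add: m)
  then show ?thesis unfolding card_zero_diagonal_on_permute[OF p pp] .
qed

lemma card_zero_diagonal_on_initial:
  assumes n: "even n" and k: "k \<le> n"
  shows "card (zero_diagonal_on n {} :: 'a::{field,finite} mat set) =
    CARD('a) ^ k * card (zero_diagonal_on n {..<k} :: 'a mat set)"
  using k
proof (induction k)
  case (Suc k)
  then show ?case using card_zero_diagonal_on_insert[OF n, of k "{..<k}", where 'a='a]
    by (simp add: lessThan_Suc)
qed simp

text \<open>
  \<open>B\<close> is the Schur complement of the corner. Solving the first equation for \<open>t\<close> identifies the
  kernel vectors \<open>(t, y)\<close> of the bordered matrix with the kernel vectors \<open>y\<close> of \<open>B\<close>.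
\<close>

lemma det_border_schur:
  fixes B :: "'a::field mat"
  assumes v: "v \<in> carrier_vec m" and B: "B \<in> carrier_mat m m" and c: "c \<noteq> 0"
  shows "det (border c v (B + mat m m (\<lambda>(i, j). v $ i * v $ j / c))) = 0 \<longleftrightarrow> det B = 0"
proof -
  let ?M = "mat m m (\<lambda>(i, j). v $ i * v $ j / c)"
  have B': "B + ?M \<in> carrier_mat m m" using B by simp
  have M: "?M *\<^sub>v y = (v \<bullet> y / c) \<cdot>\<^sub>v v" if y: "y \<in> carrier_vec m" for y
    using v y by (intro eq_vecI) (auto simp: scalar_prod_def sum_distrib_left sum_divide_distrib ac_simps)
  have mult: "border c v (B + ?M) *\<^sub>v vCons t y =
      vCons (c * t + v \<bullet> y) ((t + v \<bullet> y / c) \<cdot>\<^sub>v v + B *\<^sub>v y)" if y: "y \<in> carrier_vec m" for t y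
  proof -
    have "t \<cdot>\<^sub>v v + (B + ?M) *\<^sub>v y = (t + v \<bullet> y / c) \<cdot>\<^sub>v v + B *\<^sub>v y"
      using v B y M[OF y]
      by (intro eq_vecI) (auto simp: add_mult_distrib_mat_vec[of _ m m] algebra_simps)
    then show ?thesis using border_mult_vec[OF v B' y] by simp
  qed
  have k: "border c v (B + ?M) *\<^sub>v vCons t y = 0\<^sub>v (Suc m) \<longleftrightarrow> t = - (v \<bullet> y / c) \<and> B *\<^sub>v y = 0\<^sub>v m"
    if y: "y \<in> carrier_vec m" for t y
  proof -
    have "c * t + v \<bullet> y = 0 \<longleftrightarrow> t = - (v \<bullet> y / c)"
      using c by (auto simp: field_simps eq_neg_iff_add_eq_0)
    moreover have "(0 :: 'a) \<cdot>\<^sub>v v + B *\<^sub>v y = B *\<^sub>v y" using v B y by (intro eq_vecI) auto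
    ultimately show ?thesis unfolding mult[OF y] zero_vec_Suc by auto
  qed
  show ?thesis
  proof
    assume "det (border c v (B + ?M)) = 0"
    then obtain z where z: "z \<in> carrier_vec (Suc m)" "z \<noteq> 0\<^sub>v (Suc m)"
        "border c v (B + ?M) *\<^sub>v z = 0\<^sub>v (Suc m)"
      using det_0_iff_vec_prod_zero[OF border_carrier[OF v B']] by blast
    then obtain t y where y: "z = vCons t y" "y \<in> carrier_vec m" by (cases z) auto
    with z(3) k have "t = - (v \<bullet> y / c)" "B *\<^sub>v y = 0\<^sub>v m" by auto
    moreover have "y \<noteq> 0\<^sub>v m" using z(2) y v \<open>t = _\<close> by (auto simp: zero_vec_Suc)
    ultimately show "det B = 0" using det_0_iff_vec_prod_zero[OF B] y(2) by blast
  next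
    assume "det B = 0"
    then obtain y where y: "y \<in> carrier_vec m" "y \<noteq> 0\<^sub>v m" "B *\<^sub>v y = 0\<^sub>v m"
      using det_0_iff_vec_prod_zero[OF B] by blast
    then have "border c v (B + ?M) *\<^sub>v vCons (- (v \<bullet> y / c)) y = 0\<^sub>v (Suc m)" using k by simp
    moreover have "vCons (- (v \<bullet> y / c)) y \<noteq> 0\<^sub>v (Suc m)" using y by (simp add: zero_vec_Suc)
    ultimately show "det (border c v (B + ?M)) = 0"
      using det_0_iff_vec_prod_zero[OF border_carrier[OF v B']] y(1) by (meson vCons_carrier_vec)
  qed
qed

text \<open>
  Corner, border and Schur complement determine the matrix, and they can be prescribed independently.
  The diagonal of the block is not controlled by this parametrization, which is why it is used only
  without further diagonal conditions.
\<close>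

lemma card_nonzero_corner:
  "card (zero_diagonal_on (Suc m) {} - zero_diagonal_on (Suc m) {0} :: 'a::{field,finite} mat set) =
    (CARD('a) - 1) * CARD('a) ^ m * card (zero_diagonal_on m {} :: 'a mat set)"
proof -
  let ?M = "\<lambda>c v. mat m m (\<lambda>(i, j). v $ i * v $ j / c) :: 'a mat"
  let ?f = "\<lambda>(c, v, B). border c v (B + ?M c v)"
  let ?D = "(UNIV - {0 :: 'a}) \<times> (carrier_vec m :: 'a vec set) \<times> (zero_diagonal_on m {} :: 'a mat set)"
  let ?E = "zero_diagonal_on (Suc m) {} - zero_diagonal_on (Suc m) {0} :: 'a mat set"
  have E: "A \<in> ?E \<longleftrightarrow> A \<in> carrier_mat (Suc m) (Suc m) \<and> transpose_mat A = A \<and> det A \<noteq> 0 \<and> A $$ (0, 0) \<noteq> 0"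
    for A :: "'a mat"
    by (auto simp: zero_diagonal_on_def)
  have M: "?M c v \<in> carrier_mat m m" for c v by simp
  have tM: "transpose_mat (?M c v) = ?M c v" for c v by (rule eq_matI) (auto simp: ac_simps)
  have "bij_betw ?f ?D ?E"
  proof (rule bij_betw_imageI)
    show "inj_on ?f ?D"
    proof (rule inj_onI, clarify, goal_cases)
      case (1 c v B c' v' B')
      then have c: "B \<in> carrier_mat m m" "B' \<in> carrier_mat m m" by (auto simp: zero_diagonal_on_def)
      have e: "c = c' \<and> v = v' \<and> B + ?M c v = B' + ?M c' v'"
        by (rule border_inject[of v m _ v']) (use 1 c in auto)
      have "B $$ (i, j) = B' $$ (i, j)" if "i < m" "j < m" for i j
        using arg_cong[OF conjunct2[OF conjunct2[OF e]], of "\<lambda>A. A $$ (i, j)"] e c that by simp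
      then have "B = B'" using c by (intro eq_matI) auto
      with e 1 show ?case by simp
    qed
    show "?f ` ?D = ?E"
    proof
      show "?f ` ?D \<subseteq> ?E"
      proof (rule image_subsetI)
        fix p assume "p \<in> ?D"
        then obtain c v B where p: "p = (c, v, B)" and c: "c \<noteq> 0"
          and v: "v \<in> carrier_vec m" and "B \<in> zero_diagonal_on m {}" by auto
        then have B: "B \<in> carrier_mat m m" "transpose_mat B = B" "det B \<noteq> 0"
          by (auto simp: zero_diagonal_on_def)
        have B': "B + ?M c v \<in> carrier_mat m m" by simp
        have "transpose_mat (B + ?M c v) = B + ?M c v"
          using transpose_add[OF B(1) M] B(2) tM by simp
        then show "?f p \<in> ?E"
          unfolding E p
          using border_carrier[OF v B'] border_symmetric[OF v B'] det_border_schur[OF v B(1) c] c B(3)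
          by (simp add: border_index(1)[OF v B'])
      qed
    next
      show "?E \<subseteq> ?f ` ?D"
      proof
        fix A assume "A \<in> ?E"
        then have A: "A \<in> carrier_mat (Suc m) (Suc m)" "transpose_mat A = A" "det A \<noteq> 0" "A $$ (0, 0) \<noteq> 0"
          by (auto simp only: E)
        obtain c v B where b: "v \<in> carrier_vec m" "B \<in> carrier_mat m m" "A = border c v B"
          using border_cases[OF A(1,2)] by blast
        have c: "c \<noteq> 0" using A(4) b border_index(1) by metis
        define B' where "B' = B - ?M c v"
        have B': "B' \<in> carrier_mat m m" unfolding B'_def by (rule minus_carrier_mat[OF M])
        have BB: "B = B' + ?M c v" unfolding B'_def using b(2) by (intro eq_matI) auto
        have "transpose_mat B = B" using A(2) b border_symmetric by metis
        then have "transpose_mat B' = B'"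
          unfolding B'_def using transpose_minus[OF b(2) M] tM by simp
        moreover have "det B' \<noteq> 0"
          using det_border_schur[OF b(1) B' c] A(3) b(3) BB by simp
        ultimately have "(c, v, B') \<in> ?D" using b(1) B' c by (simp add: zero_diagonal_on_def)
        moreover have "A = ?f (c, v, B')" using b(3) BB by simp
        ultimately show "A \<in> ?f ` ?D" by (rule rev_image_eqI)
      qed
    qed
  qed
  then have "card ?E = card ?D" by (simp add: bij_betw_same_card)
  then show ?thesis
    using card_carrier_vec[of m, where 'a='a] by (simp add: card_cartesian_product card_Diff_subset)
qed

theorem theorem3p3:
  fixes F :: "'a::{field,finite} itself" and q n :: nat
  assumes "primepow q" and "CARD('a) = q"
    and "even n" and "n > 0"
  shows "sym_count F (n - 1) = sym0_count F n"
proof -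
  obtain m where n: "n = Suc m" using assms(4) by (cases n) auto
  let ?f = "card (zero_diagonal_on n {} :: 'a mat set)"
  let ?h = "card (zero_diagonal_on n {0} :: 'a mat set)"
  let ?e = "card (zero_diagonal_on m {} :: 'a mat set)"
  have q: "CARD('a) > 1" by (rule card_field_gt_1)
  have h: "?f = CARD('a) * ?h"
    using card_zero_diagonal_on_insert[OF assms(3,4), of "{}", where 'a='a] by simp
  have "zero_diagonal_on n {0} \<subseteq> (zero_diagonal_on n {} :: 'a mat set)"
    by (auto simp: zero_diagonal_on_def)
  then have "?f - ?h = (CARD('a) - 1) * CARD('a) ^ m * ?e"
    using card_nonzero_corner[of m, where 'a='a]
      card_Diff_subset[OF finite_zero_diagonal_on[of n "{0}", where 'a='a]] by (simp flip: n)
  moreover have "?f - ?h = (CARD('a) - 1) * ?h" unfolding h by (simp add: diff_mult_distrib)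
  ultimately have "?h = CARD('a) ^ m * ?e" using q by (simp add: mult.assoc)
  then have "?f = CARD('a) ^ n * ?e" using h n by simp
  moreover have "?f = CARD('a) ^ n * card (zero_diagonal_on n {..<n} :: 'a mat set)"
    using card_zero_diagonal_on_initial[OF assms(3), of n, where 'a='a] by simp
  ultimately have "?e = card (zero_diagonal_on n {..<n} :: 'a mat set)" using q by simp
  moreover have "{A \<in> sym_inv_mats F n. \<forall>i<n. A $$ (i, i) = 0} = zero_diagonal_on n {..<n}"
    by (auto simp: sym_inv_mats_eq zero_diagonal_on_def)
  ultimately show ?thesis
    by (simp add: sym_count_def sym0_count_def sym_inv_mats_eq n)
qed

end
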